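(* The open quadrant $\mathcal{Q}:=\{(x,y)\in\mathbb{R}^2:\ x>0,\ y>0\}$ is the image $f(\mathbb{R}^2)$ of the polynomial map $$ f:\mathbb{R}^2\to\mathbb{R}^2,\quad (x,y)\mapsto\big((x^2y^4+x^4y^2-y^2-1)^2+x^6y^4,\ (x^6y^2+x^2y^2-x^2-1)^2+x^6y^4\big). $$ *)

theory Defs
  imports "HOL-Analysis.Analysis"
begin

definition open_quadrant :: "(real \<times> real) set" where
  "open_quadrant = {(x, y). x > 0 \<and> y > 0}"

definition quadrant_map :: "real \<times> real \<Rightarrow> real \<times> real" where
  "quadrant_map = (\<lambda>(x, y).
     ((x^2 * y^4 + x^4 * y^2 - y^2 - 1)^2 + x^6 * y^4,
      (x^6 * y^2 + x^2 * y^2 - x^2 - 1)^2 + x^6 * y^4))"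

lemma polynomial_function_quadrant_map: "polynomial_function quadrant_map"
proof -
  have c: "real_polynomial_function (\<lambda>p. fst (quadrant_map p))"
    "real_polynomial_function (\<lambda>p. snd (quadrant_map p))"
    unfolding quadrant_map_def case_prod_beta fst_conv snd_conv
    by (intro conjI real_polynomial_function_diff real_polynomial_function.intros(3,4,2)
        real_polynomial_function_power real_polynomial_function.intros(1)
        bounded_linear_fst bounded_linear_snd)+
  show ?thesis
    unfolding polynomial_function_iff_Basis_inner real_polynomial_function_eq [symmetric]
    using c by (auto simp: Basis_prod_def inner_prod_def)
qed

end

theory Submission
  imports Defs
begin

text \<open>
Write A and B for the two polynomials that are squared in the map, so that the map is
(A^2 + T, B^2 + T) with T = x^6 y^4. All values lie in the open quadrant: off the coordinate
axes T > 0, and on the axes each of A and B is one of -1, -1 - x^2, -1 - y^2, hence nonzero.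

For surjectivity fix a target (a, b). Off the axes the map depends only on q = x^2 y^2 and
p = x^4 y^2, which range over all positive pairs, and it becomes T = p q,
A = (p - 1) + q^2 (q - 1) / p and B = (q - 1) + p (p - 1) / q. Take c = A as a parameter. The first
coordinate equals a exactly when T = a - c^2; substituting p = T / q, the equation A = c turns into
the quintic q^5 - q^4 - (1 + c) T q + T^2 = 0, and on its solutions B = c T / q^2 - (1 - q)^2.
So it remains to find a point (c, q) of this plane curve at which B^2 + T = b.

Only 0 \<le> c < sqrt a is used. There, in q, the quintic first falls and then rises, so it has at most
one root with slope at most 0 and at most one with slope at least 0. These roots form two branches,
which depend continuously on c because their graphs are closed and bounded
(\<open>continuous_branch\<close>). As c tends to sqrt a, T tends to 0; then B^2 + T tends to infinity on
the falling branch and to 0 on the rising branch (\<open>second_near_end\<close>). Start at such a c and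
decrease it. If the two roots merge before c = 0, the two branches join there to one connected curve,
on which B^2 + T passes from below b to above b. Otherwise both branches reach c = 0, where T = a.
If b \<le> a, the rising branch suffices, since B^2 + T \<ge> a at its end c = 0. If b > a, the falling
branch suffices: at c = 0 one has B = -(1 - q)^2 \<le> 0 while B > 0 near sqrt a, so B vanishes
somewhere, and there B^2 + T = T \<le> a < b. The intermediate value theorem concludes in each case
(\<open>curve_point_with_second_value\<close>).
\<close>

section \<open>Positive roots of the quintic\<close>

definition quintic :: "real \<Rightarrow> real \<Rightarrow> real \<Rightarrow> real" where
  "quintic m n q = q^5 - q^4 - m * q + n"

definition slope :: "real \<Rightarrow> real \<Rightarrow> real" where
  "slope m q = q^3 * (5 * q - 4) - m"

lemma quintic_has_slope: "(quintic m n has_real_derivative slope m q) (at q)"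
  unfolding quintic_def slope_def
  by (auto intro!: derivative_eq_intros simp: algebra_simps eval_nat_numeral)

lemma continuous_on_quintic: "continuous_on S (quintic m n)"
  unfolding quintic_def by (intro continuous_intros)

text \<open>
Only the factor 5 q - 4 can be negative, and where q^3 (5 q - 4) is positive it increases. Hence the
slope changes sign at most once on the nonnegative half-line, from negative to positive.
\<close>
lemma slope_pos_right:
  assumes "0 < m" "0 \<le> x" "x < y" "0 \<le> slope m x"
  shows "0 < slope m y"
proof -
  have pos: "0 < x^3 * (5 * x - 4)"
    using assms by (simp add: slope_def)
  then have "0 < 5 * x - 4"
    using assms(2) by (smt (verit) mult_nonneg_nonpos zero_le_power)
  then have "x^3 * (5 * x - 4) < y^3 * (5 * y - 4)"
    using assms by (intro mult_strict_mono power_strict_mono) auto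
  then show ?thesis
    using assms(4) by (simp add: slope_def)
qed

text \<open>
Two roots have a critical point between them, by Rolle, and the slope changes sign only there. This
makes a root unique once the sign of its slope is prescribed.
\<close>
lemma slopes_at_two_roots:
  assumes "0 < m" "0 \<le> z" "z < z'" "quintic m n z = 0" "quintic m n z' = 0"
  shows "slope m z < 0" "0 < slope m z'"
proof -
  obtain x where x: "z < x" "x < z'" "quintic m n z' - quintic m n z = (z' - z) * slope m x"
    using MVT2 [OF assms(3)] quintic_has_slope by blast
  then have "slope m x = 0"
    using assms by simp
  then show "slope m z < 0" "0 < slope m z'"
    using slope_pos_right [of m z x] slope_pos_right [of m x z'] x assms by force+
qed

lemma quintic_pos_beyond:
  assumes "0 < m" "0 < n" "1 + m \<le> q"
  shows "0 < quintic m n q"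
proof -
  have "m * 1 \<le> (q - 1) * q^3"
    using assms by (intro mult_mono) auto
  then have "m * q \<le> ((q - 1) * q^3) * q"
    using assms by (intro mult_right_mono) auto
  then show ?thesis
    using assms(2) by (simp add: quintic_def algebra_simps eval_nat_numeral)
qed

lemma two_roots_around_negative:
  assumes "0 < m" "0 < n" "0 \<le> x" "quintic m n x < 0"
  obtains z z' where "0 \<le> z" "z < z'" "quintic m n z = 0" "quintic m n z' = 0"
proof -
  have 0: "quintic m n 0 > 0"
    using assms by (simp add: quintic_def)
  obtain z where z: "0 \<le> z" "z \<le> x" "quintic m n z = 0"
    using IVT2' [of "quintic m n" x 0 0] 0 assms continuous_on_quintic by fastforce
  have "x \<le> 1 + m"
    using quintic_pos_beyond [of m n x] assms by force
  then obtain z' where z': "x \<le> z'" "quintic m n z' = 0"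
    using IVT' [of "quintic m n" x 0 "1 + m"] quintic_pos_beyond [of m n "1 + m"] assms
      continuous_on_quintic by fastforce
  have "z \<noteq> z'"
    using z z' assms by auto
  then show thesis
    using that [of z z'] z z' by simp
qed

text \<open>The situation at a fold, where the two roots have merged into a double root.\<close>
lemma slope_zero_at_minimal_root:
  assumes "0 < n" "0 \<le> z" "quintic m n z = 0" "\<And>q. 0 \<le> q \<Longrightarrow> 0 \<le> quintic m n q"
  shows "slope m z = 0"
proof -
  have "z \<noteq> 0"
    using assms(1,3) by (auto simp: quintic_def)
  then have "0 < z"
    using assms(2) by simp
  moreover have "\<forall>y. \<bar>z - y\<bar> < z \<longrightarrow> quintic m n z \<le> quintic m n y"
    using assms(4) by (auto simp: assms(3))
  ultimately show ?thesis
    using DERIV_local_min [OF quintic_has_slope] by blast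
qed

section \<open>The fibre of the first coordinate as a plane curve\<close>

text \<open>The value left for the common summand x^6 y^4 when the first squared polynomial equals c.\<close>
abbreviation (input) excess :: "real \<Rightarrow> real \<Rightarrow> real" where
  "excess a c \<equiv> a - c^2"

text \<open>
On the zero set of this function the first coordinate of the map is a; the parameters are c, the value
of the first squared polynomial, and q = x^2 y^2.
\<close>
definition curve :: "real \<Rightarrow> real \<Rightarrow> real \<Rightarrow> real" where
  "curve a c q = quintic ((1 + c) * excess a c) ((excess a c)^2) q"

definition curve_slope :: "real \<Rightarrow> real \<Rightarrow> real \<Rightarrow> real" where
  "curve_slope a c q = slope ((1 + c) * excess a c) q"

text \<open>The second squared polynomial of the map, in the parameters c and q on the curve.\<close>
definition inner :: "real \<Rightarrow> real \<Rightarrow> real \<Rightarrow> real" where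
  "inner a c q = c * excess a c / q^2 - (1 - q)^2"

definition second :: "real \<Rightarrow> real \<Rightarrow> real \<Rightarrow> real" where
  "second a c q = (inner a c q)^2 + excess a c"

text \<open>
With t the excess, the equations x^2 y^2 = q and x^6 y^4 = t give x^2 = t / q^2 and y^2 = q^3 / t.
Both defining identities then hold up to a multiple of the quintic.
\<close>
lemma quadrant_map_at_curve_point:
  assumes "0 < q" "0 < excess a c" "curve a c q = 0"
  shows "(a, second a c q) \<in> range quadrant_map"
proof -
  define t where "t = excess a c"
  define u where "u = t / q^2"
  define v where "v = q^3 / t"
  have t: "0 < t" "t \<noteq> 0" "q \<noteq> 0"
    using assms t_def by auto
  have uv: "0 \<le> u" "0 \<le> v"
    using assms t by (auto simp: u_def v_def)
  have root: "q^5 - q^4 - (1 + c) * t * q + t^2 = 0"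
    using assms(3) by (simp add: curve_def quintic_def t_def)
  have prods: "u * v = q" "u^2 * v = t / q" "u * v^2 = q^4 / t" "u^3 * v = t^2 / q^3" "u^3 * v^2 = t"
    using t by (simp_all add: u_def v_def field_simps eval_nat_numeral)
  have A: "u * v^2 + u^2 * v - v - 1 = c"
  proof -
    have "u * v^2 + u^2 * v - v - 1 - c = (q^5 - q^4 - (1 + c) * t * q + t^2) / (t * q)"
      unfolding prods unfolding v_def using t by (simp add: field_simps eval_nat_numeral)
    then show ?thesis
      using root by simp
  qed
  have B: "u^3 * v + u * v - u - 1 = inner a c q"
  proof -
    have "u^3 * v + u * v - u - 1 - inner a c q
        = (q^5 - q^4 - (1 + c) * t * q + t^2) / q^3"
      unfolding prods inner_def t_def [symmetric] unfolding u_def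
      using t by (simp add: field_simps eval_nat_numeral)
    then show ?thesis
      using root by simp
  qed
  have sq: "sqrt u ^ 2 = u" "sqrt v ^ 2 = v" "sqrt u ^ 4 = u^2" "sqrt v ^ 4 = v^2" "sqrt u ^ 6 = u^3"
    using uv power_mult [of "sqrt u" 2 2] power_mult [of "sqrt v" 2 2] power_mult [of "sqrt u" 2 3]
    by simp_all
  have "quadrant_map (sqrt u, sqrt v) = (c^2 + t, (inner a c q)^2 + t)"
    by (simp add: quadrant_map_def sq A B prods(5))
  then have "quadrant_map (sqrt u, sqrt v) = (a, second a c q)"
    by (simp add: second_def t_def)
  then show ?thesis
    by (metis rangeI)
qed

lemma excess_pos:
  assumes "0 \<le> c" "c \<le> h" "h^2 < a"
  shows "0 < excess a c" "0 < (1 + c) * excess a c" "(1 + c) * excess a c \<le> (1 + h) * a"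
proof -
  show *: "0 < excess a c"
    using assms power_mono [of c h 2] by linarith
  then show "0 < (1 + c) * excess a c"
    using assms by simp
  show "(1 + c) * excess a c \<le> (1 + h) * a"
    using assms * by (intro mult_mono) auto
qed

lemma continuous_on_curve: "continuous_on S (\<lambda>x. curve a (fst x) (snd x))"
  unfolding curve_def quintic_def by (intro continuous_intros)

text \<open>
The bound is uniform in c, so that the part of the curve over a compact interval of parameters
is compact.
\<close>
lemma curve_root_bounds:
  assumes "0 \<le> c" "c \<le> h" "h^2 < a" "0 \<le> q" "curve a c q = 0"
  shows "0 < q" "q \<le> 1 + (1 + h) * a"
proof -
  note pos = excess_pos [OF assms(1-3)]
  show "0 < q"
    using assms pos by (cases "q = 0") (auto simp: curve_def quintic_def)
  have "\<not> 1 + (1 + c) * excess a c \<le> q"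
    using quintic_pos_beyond [OF pos(2), of "(excess a c)^2" q] assms(5) pos(1)
    by (auto simp: curve_def)
  then show "q \<le> 1 + (1 + h) * a"
    using pos by linarith
qed

section \<open>The two branches of the curve\<close>

text \<open>The sign s selects the branch: falling for s = -1, rising for s = 1.\<close>
lemma branch_unique:
  assumes "0 \<le> c" "c \<le> h" "h^2 < a" "s \<in> {-1, 1}"
    and "0 \<le> q" "curve a c q = 0" "0 \<le> s * curve_slope a c q"
    and "0 \<le> q'" "curve a c q' = 0" "0 \<le> s * curve_slope a c q'"
  shows "q = q'"
proof -
  have False if "0 \<le> x" "x < y" "curve a c x = 0" "curve a c y = 0"
      "0 \<le> s * curve_slope a c x" "0 \<le> s * curve_slope a c y" for x y
    using slopes_at_two_roots [OF excess_pos(2) [OF assms(1-3)], of x y "(excess a c)^2"] that assms(4)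
    by (auto simp: curve_def curve_slope_def)
  then show ?thesis
    using assms(5-) by (cases q q' rule: linorder_cases) blast+
qed

text \<open>
The sign condition on the slope is a weak inequality, so the graph of the branch is a closed subset of
a compact rectangle. A function with such a graph is continuous, and this argument includes a fold,
where the slope vanishes and the two branches meet.
\<close>
lemma continuous_branch:
  assumes "0 \<le> l" "h^2 < a" "s \<in> {-1, 1}"
    and ex: "\<And>c. l \<le> c \<Longrightarrow> c \<le> h \<Longrightarrow> \<exists>q\<ge>0. curve a c q = 0 \<and> 0 \<le> s * curve_slope a c q"
  obtains \<phi> where "continuous_on {l..h} \<phi>"
    "\<And>c. l \<le> c \<Longrightarrow> c \<le> h \<Longrightarrow> 0 < \<phi> c \<and> curve a c (\<phi> c) = 0 \<and> 0 \<le> s * curve_slope a c (\<phi> c)"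
proof -
  obtain \<phi> where \<phi>: "\<And>c. l \<le> c \<Longrightarrow> c \<le> h \<Longrightarrow>
      0 \<le> \<phi> c \<and> curve a c (\<phi> c) = 0 \<and> 0 \<le> s * curve_slope a c (\<phi> c)"
    using ex by metis
  define R where "R = {x. curve a (fst x) (snd x) = 0 \<and> 0 \<le> s * curve_slope a (fst x) (snd x)}"
  have "closed R"
    unfolding R_def curve_slope_def slope_def
    by (intro closed_Collect_conj closed_Collect_eq closed_Collect_le continuous_on_curve continuous_intros)
  define J where "J = {0..1 + (1 + h) * a}"
  have J: "\<phi> c \<in> J" if "l \<le> c" "c \<le> h" for c
    using curve_root_bounds [of c h a "\<phi> c"] \<phi> [OF that] that assms by (auto simp: J_def)
  have graph: "(\<lambda>c. (c, \<phi> c)) ` {l..h} = ({l..h} \<times> J) \<inter> R"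
  proof
    show "(\<lambda>c. (c, \<phi> c)) ` {l..h} \<subseteq> ({l..h} \<times> J) \<inter> R"
      using \<phi> J by (auto simp: R_def)
    have "q = \<phi> c" if "l \<le> c" "c \<le> h" "q \<in> J" "(c, q) \<in> R" for c q
      using branch_unique [of c h a s q "\<phi> c"] \<phi> [OF that(1,2)] that assms
      by (auto simp: R_def J_def)
    then show "({l..h} \<times> J) \<inter> R \<subseteq> (\<lambda>c. (c, \<phi> c)) ` {l..h}"
      by auto
  qed
  have "continuous_on {l..h} \<phi>"
  proof (rule continuous_from_closed_graph)
    show "compact J"
      by (simp add: J_def)
    show "closed ((\<lambda>c. (c, \<phi> c)) ` {l..h})"
      unfolding graph using \<open>closed R\<close> by (intro closed_Int closed_Times) (auto simp: J_def)
  qed (use J in auto)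
  moreover have "0 < \<phi> c" if "l \<le> c" "c \<le> h" for c
    using curve_root_bounds(1) [of c h a "\<phi> c"] \<phi> [OF that] that assms by auto
  ultimately show thesis
    using that \<phi> by blast
qed

lemma continuous_on_inner_branch:
  assumes "continuous_on {l..h} \<phi>" "\<And>c. l \<le> c \<Longrightarrow> c \<le> h \<Longrightarrow> 0 < \<phi> c"
  shows "continuous_on {l..h} (\<lambda>c. inner a c (\<phi> c))"
  unfolding inner_def using assms by (intro continuous_intros) force+

lemma continuous_on_second_branch:
  assumes "continuous_on {l..h} \<phi>" "\<And>c. l \<le> c \<Longrightarrow> c \<le> h \<Longrightarrow> 0 < \<phi> c"
  shows "continuous_on {l..h} (\<lambda>c. second a c (\<phi> c))"
  unfolding second_def using assms by (intro continuous_intros continuous_on_inner_branch)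

lemma branches_of_negative:
  assumes "0 \<le> c" "c \<le> h" "h^2 < a" "0 \<le> x" "curve a c x < 0" "s \<in> {-1, 1}"
  shows "\<exists>q\<ge>0. curve a c q = 0 \<and> 0 \<le> s * curve_slope a c q"
proof -
  note pos = excess_pos [OF assms(1-3)]
  obtain z z' where z: "0 \<le> z" "z < z'" "curve a c z = 0" "curve a c z' = 0"
    using two_roots_around_negative [OF pos(2), of "(excess a c)^2" x] pos(1) assms
    by (auto simp: curve_def)
  then have "curve_slope a c z < 0" "0 < curve_slope a c z'"
    using slopes_at_two_roots [OF pos(2), of z z'] by (auto simp: curve_def curve_slope_def)
  then show ?thesis
    using z assms(6) by (auto intro: exI [of _ z] exI [of _ z'])
qed

text \<open>
The parameters at which the quintic has no negative value form a compact set. If it is nonempty, its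
largest element l is the fold: for parameters slightly above l there are roots, which accumulate at
a root z over l by compactness, and z is a minimum.
\<close>
lemma fold_or_all_negative:
  assumes "0 \<le> h" "h^2 < a" "0 \<le> x" "curve a h x < 0"
  obtains
    (negative) "\<And>c. 0 \<le> c \<Longrightarrow> c \<le> h \<Longrightarrow> \<exists>q\<ge>0. curve a c q < 0"
  | (fold) l z where "0 \<le> l" "l < h" "0 \<le> z" "curve a l z = 0" "curve_slope a l z = 0"
      "\<And>c. l < c \<Longrightarrow> c \<le> h \<Longrightarrow> \<exists>q\<ge>0. curve a c q < 0"
proof -
  define S where "S = {0..h} \<inter> (\<Inter>q\<in>{0..}. {c. 0 \<le> curve a c q})"
  have S_iff: "c \<in> S \<longleftrightarrow> 0 \<le> c \<and> c \<le> h \<and> (\<forall>q\<ge>0. 0 \<le> curve a c q)" for c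
    unfolding S_def Int_iff INT_iff by (simp add: Ball_def)
  have "closed {c. 0 \<le> curve a c q}" for q
    unfolding curve_def quintic_def by (intro closed_Collect_le continuous_intros)
  then have S: "compact S"
    unfolding S_def by (intro compact_Int_closed closed_INT ballI) simp_all
  show thesis
  proof (cases "S = {}")
    case True
    then show thesis
      using negative S_iff by (metis empty_iff not_le)
  next
    case False
    then obtain l where l: "l \<in> S" "\<And>c. c \<in> S \<Longrightarrow> c \<le> l"
      using compact_attains_sup [OF S] by blast
    have "h \<notin> S"
      using assms S_iff by (meson not_le)
    with l(1) have lh: "0 \<le> l" "l < h"
      using S_iff [of l] by (auto simp: order_less_le)
    have neg: "\<exists>q\<ge>0. curve a c q < 0" if "l < c" "c \<le> h" for c
      using l(2) [of c] that lh S_iff [of c] by (meson not_le order_trans less_imp_le)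
    define Z where "Z = ({0..h} \<times> {0..1 + (1 + h) * a}) \<inter> {x. curve a (fst x) (snd x) = 0}"
    have "compact Z"
      unfolding Z_def
      by (intro compact_Int_closed compact_Times closed_Collect_eq continuous_on_curve continuous_intros) auto
    then have cl: "closed (fst ` Z)"
      by (intro compact_imp_closed compact_continuous_image continuous_intros)
    have "{l<..<h} \<subseteq> fst ` Z"
    proof
      fix c assume c: "c \<in> {l<..<h}"
      then obtain x' where "0 \<le> x'" "curve a c x' < 0"
        using neg [of c] by auto
      then obtain q where "0 \<le> q" "curve a c q = 0"
        using branches_of_negative [of c h a x' 1] c lh assms by auto
      then have "(c, q) \<in> Z"
        using curve_root_bounds [of c h a q] c lh assms by (auto simp: Z_def)
      then show "c \<in> fst ` Z"
        by force
    qed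
    then have "closure {l<..<h} \<subseteq> fst ` Z"
      using cl by (rule closure_minimal)
    then have "l \<in> fst ` Z"
      using lh by (auto simp: closure_greaterThanLessThan)
    then obtain z where z: "0 \<le> z" "curve a l z = 0"
      by (auto simp: Z_def)
    have "curve_slope a l z = 0"
      unfolding curve_slope_def
    proof (rule slope_zero_at_minimal_root)
      show "0 < (excess a l)^2"
        using excess_pos(1) [of l h a] lh assms by auto
    qed (use z l(1) S_iff [of l] in \<open>simp_all add: curve_def\<close>)
    then show thesis
      using fold lh z neg by blast
  qed
qed

section \<open>Behaviour as the parameter approaches its upper end\<close>

text \<open>
When the excess tends to 0 the quintic tends to q^5 - q^4, which is negative on the open unit
interval. So an interior point such as 3/4 separates the two roots once the excess is small.
\<close>
lemma curve_negative_near_end: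
  assumes "0 \<le> c" "0 < excess a c" "excess a c \<le> 1/4"
  shows "curve a c (3/4) < 0"
proof -
  define t where "t = excess a c"
  have "t * t \<le> 1/4 * (1/4)"
    using assms by (intro mult_mono) (auto simp: t_def)
  moreover have "0 \<le> (1 + c) * t"
    using assms by (simp add: t_def)
  ultimately show ?thesis
    unfolding curve_def quintic_def t_def [symmetric] by (simp add: power2_eq_square eval_nat_numeral)
qed

text \<open>
On the falling branch q < 1 if the excess t is small, so the quintic equation forces
(1 + c) q \<le> t. Hence q \<le> t, and the term c t / q^2 is at least c / t, which is large.
\<close>
lemma inner_falling_branch_ge:
  assumes "0 \<le> c" "0 < excess a c" "(1 + c) * excess a c \<le> 1/4"
    and "0 < q" "curve a c q = 0" "curve_slope a c q \<le> 0"
  shows "c / excess a c - 1 \<le> inner a c q"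
proof -
  define t where "t = excess a c"
  have t: "0 < t" "(1 + c) * t \<le> 1/4"
    using assms by (auto simp: t_def)
  have q1: "q < 1"
  proof (rule ccontr)
    assume "\<not> q < 1"
    then have "1 * 1 \<le> q^3 * (5 * q - 4)"
      by (intro mult_mono) auto
    then show False
      using assms(6) t by (simp add: curve_slope_def slope_def t_def)
  qed
  have "q^4 * (1 - q) = t^2 - (1 + c) * t * q"
    using assms(5) by (simp add: curve_def quintic_def t_def algebra_simps eval_nat_numeral)
  moreover have "0 \<le> q^4 * (1 - q)"
    using q1 assms by auto
  ultimately have "t * ((1 + c) * q) \<le> t * t"
    by (simp add: power2_eq_square algebra_simps)
  then have "(1 + c) * q \<le> t"
    using t by simp
  moreover have "q \<le> (1 + c) * q"
    using assms by (simp add: algebra_simps)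
  ultimately have "q \<le> t"
    by simp
  then have "q^2 \<le> t^2"
    using assms by (intro power_mono) auto
  then have "c * t / t^2 \<le> c * t / q^2"
    using assms t by (intro divide_left_mono) auto
  moreover have "c * t / t^2 = c / t"
    using t by (simp add: power2_eq_square)
  moreover have "(1 - q)^2 \<le> 1"
    using q1 assms by (intro power_le_one) auto
  ultimately show ?thesis
    unfolding inner_def t_def [symmetric] by linarith
qed

text \<open>
On the rising branch q stays above 4/5, and the equation divided by q^4 reads
q - 1 = (1 + c) t / q^3 - t^2 / q^4. Thus q tends to 1 at a linear rate as the excess t vanishes.
\<close>
lemma abs_inner_rising_branch_le:
  assumes "0 \<le> c" "0 < excess a c" "excess a c \<le> 1"
    and "0 < q" "curve a c q = 0" "0 \<le> curve_slope a c q"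
  shows "\<bar>inner a c q\<bar> \<le> 2 * c * excess a c + (5 * (1 + c) * excess a c)^2"
proof -
  define t where "t = excess a c"
  have t: "0 < t" "t \<le> 1"
    using assms by (auto simp: t_def)
  have "0 < (1 + c) * t"
    using assms t by simp
  then have "0 < q^3 * (5 * q - 4)"
    using assms(6) by (simp add: curve_slope_def slope_def t_def)
  then have q: "4/5 \<le> q"
    using assms(4) by (simp add: zero_less_mult_iff)
  have "(4/5)^2 \<le> q^2" "(4/5)^3 \<le> q^3" "(4/5)^4 \<le> q^4"
    using q by (intro power_mono; simp)+
  then have pw: "1/2 \<le> q^2" "1/2 \<le> q^3" "1/3 \<le> q^4"
    by (simp_all add: power_divide)
  have "q^4 * (q - 1) = t * ((1 + c) * q - t)"
    using assms(5) by (simp add: curve_def quintic_def t_def algebra_simps eval_nat_numeral)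
  then have "q - 1 = t * ((1 + c) * q - t) / q^4"
    using assms(4) by (simp add: eq_divide_eq mult.commute)
  also have "\<dots> = (1 + c) * t / q^3 - t * t / q^4"
    using assms(4) by (simp add: field_simps eval_nat_numeral)
  finally have "q - 1 = (1 + c) * t / q^3 - t * t / q^4" .
  moreover have "(1 + c) * t / q^3 \<le> (1 + c) * t / (1/2)"
    using assms t pw by (intro divide_left_mono) auto
  moreover have "t * t / q^4 \<le> t * t / (1/3)"
    using assms t pw by (intro divide_left_mono) auto
  moreover have "0 \<le> (1 + c) * t / q^3" "0 \<le> t * t / q^4"
    using assms t by auto
  moreover have "t * t \<le> (1 + c) * t"
    using assms t by (intro mult_right_mono) auto
  moreover have "\<bar>1 - q\<bar> \<le> 5 * m" if "q - 1 = x - y" "x \<le> m / (1/2)" "y \<le> w / (1/3)"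
      "0 \<le> x" "0 \<le> y" "w \<le> m" "0 < m" for x y m w :: real
    using that by simp
  ultimately have "\<bar>1 - q\<bar> \<le> 5 * ((1 + c) * t)"
    using \<open>0 < (1 + c) * t\<close> by metis
  then have "\<bar>1 - q\<bar> \<le> 5 * (1 + c) * t"
    by (simp only: mult.assoc)
  then have *: "(1 - q)^2 \<le> (5 * (1 + c) * t)^2"
    by (rule power2_le_iff_abs_le [THEN iffD2, rotated]) (use assms t in auto)
  have "c * t / q^2 \<le> c * t / (1/2)"
    using assms t pw by (intro divide_left_mono) auto
  moreover have ct: "0 \<le> c * t" "0 \<le> c * t / q^2"
    using assms t by auto
  ultimately have **: "c * t / q^2 \<le> 2 * c * t"
    by simp
  show ?thesis
    unfolding inner_def t_def [symmetric] using * ** ct zero_le_power2 [of "1 - q"]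
      zero_le_power2 [of "5 * (1 + c) * t"] by linarith
qed

text \<open>
The excess t is chosen first and h = sqrt (a - t) afterwards. The bounds e \<le> h \<le> r, with
e = sqrt (a / 2) and r = sqrt a, replace h in both estimates, so that the smallness conditions on t
do not involve h.
\<close>
lemma second_near_end:
  fixes a b :: real
  assumes "0 < a" "0 < b"
  obtains h where "0 < h" "h^2 < a" "curve a h (3/4) < 0"
    "\<And>q. 0 < q \<Longrightarrow> curve a h q = 0 \<Longrightarrow> curve_slope a h q \<le> 0 \<Longrightarrow> sqrt b \<le> inner a h q"
    "\<And>q. 0 < q \<Longrightarrow> curve a h q = 0 \<Longrightarrow> 0 \<le> curve_slope a h q \<Longrightarrow> second a h q \<le> b"
proof -
  define r where "r = sqrt a"
  define e where "e = sqrt (a / 2)"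
  have re: "0 < r" "0 < e" "r^2 = a" "e^2 = a / 2"
    using assms by (auto simp: r_def e_def)
  let ?bd = "\<lambda>t. (2 * r * t + (5 * (1 + r) * t)^2)^2 + t"
  have ev: "\<forall>\<^sub>F t in at_right 0. f t < d" if "isCont f 0" "f 0 < d" for f :: "real \<Rightarrow> real" and d
  proof -
    have "(f \<longlongrightarrow> f 0) (at_right 0)"
      using that(1) by (simp add: isCont_def filterlim_at_split)
    then show ?thesis
      using that(2) by (rule order_tendstoD(2))
  qed
  have small: "\<forall>\<^sub>F t in at_right (0::real). 0 < t \<and> t < 1/4 \<and> t < a / 2 \<and> (1 + r) * t < 1/4
      \<and> t * (1 + sqrt b) < e \<and> ?bd t < b"
    using assms re
    by (intro eventually_conj eventually_at_right_less ev continuous_intros) auto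
  obtain t where t: "0 < t" "t < 1/4" "t < a / 2" "(1 + r) * t < 1/4"
      "t * (1 + sqrt b) < e" "?bd t < b"
    using eventually_happens' [OF trivial_limit_at_right_real small] by blast
  define h where "h = sqrt (a - t)"
  have h: "0 < h" "h^2 = a - t" "h \<le> r" "e \<le> h"
    using t assms by (auto simp: h_def r_def e_def)
  have T: "excess a h = t"
    using h by simp
  have "(1 + h) * t \<le> (1 + r) * t"
    using h t by (intro mult_right_mono) auto
  then have m: "(1 + h) * t \<le> 1/4"
    using t(4) by linarith
  show thesis
  proof
    show "0 < h" "h^2 < a"
      using h t by auto
    show "curve a h (3/4) < 0"
      using h t by (intro curve_negative_near_end) auto
  next
    fix q assume "0 < q" "curve a h q = 0" "curve_slope a h q \<le> 0"
    then have "h / t - 1 \<le> inner a h q"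
      using inner_falling_branch_ge [of h a q] h t m by (simp add: T)
    moreover have "1 + sqrt b \<le> h / t"
      using t h by (simp add: field_simps)
    ultimately show "sqrt b \<le> inner a h q"
      by linarith
  next
    fix q assume "0 < q" "curve a h q = 0" "0 \<le> curve_slope a h q"
    then have "\<bar>inner a h q\<bar> \<le> 2 * h * t + (5 * (1 + h) * t)^2"
      using abs_inner_rising_branch_le [of h a q] h t by (simp add: T)
    also have "\<dots> \<le> 2 * r * t + (5 * (1 + r) * t)^2"
      using h t by (intro add_mono mult_mono power_mono) auto
    finally have "(inner a h q)^2 \<le> (2 * r * t + (5 * (1 + r) * t)^2)^2"
      by (rule power2_le_iff_abs_le [THEN iffD2, rotated]) (use re t in auto)
    then show "second a h q \<le> b"
      using t by (simp add: second_def T)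
  qed
qed

lemma two_branches:
  assumes "0 \<le> l" "h^2 < a"
    and "\<And>c s. l \<le> c \<Longrightarrow> c \<le> h \<Longrightarrow> s \<in> {-1, 1} \<Longrightarrow>
      \<exists>q\<ge>0. curve a c q = 0 \<and> 0 \<le> s * curve_slope a c q"
  obtains \<phi> \<psi> where "continuous_on {l..h} \<phi>" "continuous_on {l..h} \<psi>"
    "\<And>c. l \<le> c \<Longrightarrow> c \<le> h \<Longrightarrow> 0 < \<phi> c \<and> curve a c (\<phi> c) = 0 \<and> curve_slope a c (\<phi> c) \<le> 0"
    "\<And>c. l \<le> c \<Longrightarrow> c \<le> h \<Longrightarrow> 0 < \<psi> c \<and> curve a c (\<psi> c) = 0 \<and> 0 \<le> curve_slope a c (\<psi> c)"
proof -
  obtain \<phi> where 1: "continuous_on {l..h} \<phi>"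
    "\<And>c. l \<le> c \<Longrightarrow> c \<le> h \<Longrightarrow> 0 < \<phi> c \<and> curve a c (\<phi> c) = 0 \<and> 0 \<le> -1 * curve_slope a c (\<phi> c)"
    using continuous_branch [OF assms(1,2), of "-1"] assms(3) by blast
  obtain \<psi> where 2: "continuous_on {l..h} \<psi>"
    "\<And>c. l \<le> c \<Longrightarrow> c \<le> h \<Longrightarrow> 0 < \<psi> c \<and> curve a c (\<psi> c) = 0 \<and> 0 \<le> 1 * curve_slope a c (\<psi> c)"
    using continuous_branch [OF assms(1,2), of 1] assms(3) by blast
  show thesis
    using that [of \<phi> \<psi>] 1 2 by simp
qed

section \<open>Reaching every value of the second coordinate\<close>

text \<open>
With a fold, the two branches together lead from values at most b to values at least b. Without one
they need not meet, and each has to reach b alone: the rising branch does so if b \<le> a, the falling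
branch if b > a.
\<close>
lemma curve_point_with_second_value:
  fixes a b :: real
  assumes "0 < a" "0 < b"
  obtains c q where "0 < q" "0 < excess a c" "curve a c q = 0" "second a c q = b"
proof -
  note solution = that
  obtain h where h: "0 < h" "h^2 < a" "curve a h (3/4) < 0"
    and high: "\<And>q. 0 < q \<Longrightarrow> curve a h q = 0 \<Longrightarrow> curve_slope a h q \<le> 0 \<Longrightarrow> sqrt b \<le> inner a h q"
    and low: "\<And>q. 0 < q \<Longrightarrow> curve a h q = 0 \<Longrightarrow> 0 \<le> curve_slope a h q \<Longrightarrow> second a h q \<le> b"
    using second_near_end [OF assms] by metis
  have high': "b \<le> second a h q"
    if "0 < q" "curve a h q = 0" "curve_slope a h q \<le> 0" for q
  proof -
    have "(sqrt b)^2 \<le> (inner a h q)^2"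
      using high [OF that] assms by (intro power_mono) auto
    then show ?thesis
      using assms h by (simp add: second_def)
  qed
  have found: thesis if "0 \<le> c" "c \<le> h" "0 < q" "curve a c q = 0" "second a c q = b" for c q
    using solution that(3-5) excess_pos(1) [OF that(1,2) h(2)] by blast
  consider
    (negative) "\<And>c. 0 \<le> c \<Longrightarrow> c \<le> h \<Longrightarrow> \<exists>q\<ge>0. curve a c q < 0"
  | (fold) l z where "0 \<le> l" "l < h" "0 \<le> z" "curve a l z = 0" "curve_slope a l z = 0"
      "\<And>c. l < c \<Longrightarrow> c \<le> h \<Longrightarrow> \<exists>q\<ge>0. curve a c q < 0"
    using fold_or_all_negative [of h a "3/4"] h by (metis less_imp_le zero_le_divide_iff zero_le_numeral)
  then show thesis
  proof cases
    case negative
    have "\<exists>q\<ge>0. curve a c q = 0 \<and> 0 \<le> s * curve_slope a c q"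
      if c: "0 \<le> c" "c \<le> h" "s \<in> {-1, 1}" for c s
      using negative [OF c(1,2)] branches_of_negative [OF c(1,2) h(2) _ _ c(3)] by blast
    then obtain \<phi> \<psi> where \<phi>\<psi>: "continuous_on {0..h} \<phi>" "continuous_on {0..h} \<psi>"
      and \<phi>: "\<And>c. 0 \<le> c \<Longrightarrow> c \<le> h \<Longrightarrow> 0 < \<phi> c \<and> curve a c (\<phi> c) = 0 \<and> curve_slope a c (\<phi> c) \<le> 0"
      and \<psi>: "\<And>c. 0 \<le> c \<Longrightarrow> c \<le> h \<Longrightarrow> 0 < \<psi> c \<and> curve a c (\<psi> c) = 0 \<and> 0 \<le> curve_slope a c (\<psi> c)"
      using two_branches [of 0 h a] h(2) by blast
    show thesis
    proof (cases "b \<le> a")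
      case True
      \<comment> \<open>At c = 0 the excess alone is a.\<close>
      have "b \<le> second a 0 (\<psi> 0)"
        using True by (simp add: second_def add_increasing)
      moreover have "second a h (\<psi> h) \<le> b"
        using low \<psi> h(1) by simp
      moreover have "continuous_on {0..h} (\<lambda>c. second a c (\<psi> c))"
        using \<phi>\<psi>(2) \<psi> by (intro continuous_on_second_branch) auto
      ultimately obtain c where "0 \<le> c" "c \<le> h" "second a c (\<psi> c) = b"
        using IVT2' [of "\<lambda>c. second a c (\<psi> c)" h b 0] h(1) by auto
      then show thesis
        using \<psi> found by blast
    next
      case False
      \<comment> \<open>A point where the inner value vanishes has second value at most a, hence below b; it serves
        as the left end for the intermediate value theorem.\<close>
      have "sqrt b \<le> inner a h (\<phi> h)"
        using high \<phi> h(1) by simp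
      then have "inner a 0 (\<phi> 0) \<le> 0" "0 \<le> inner a h (\<phi> h)"
        using real_sqrt_ge_zero [of b] assms by (simp add: inner_def, linarith)
      moreover have "continuous_on {0..h} (\<lambda>c. inner a c (\<phi> c))"
        using \<phi>\<psi>(1) \<phi> by (intro continuous_on_inner_branch) auto
      ultimately obtain c0 where c0: "0 \<le> c0" "c0 \<le> h" "inner a c0 (\<phi> c0) = 0"
        using IVT' [of "\<lambda>c. inner a c (\<phi> c)" 0 0 h] h(1) by auto
      have "second a c0 (\<phi> c0) \<le> b"
        using c0(3) False by (simp add: second_def) (use zero_le_power2 [of c0] in linarith)
      moreover have "b \<le> second a h (\<phi> h)"
        using high' \<phi> h(1) by simp
      moreover have "continuous_on {c0..h} (\<lambda>c. second a c (\<phi> c))"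
        using c0 \<phi> by (intro continuous_on_second_branch continuous_on_subset [OF \<phi>\<psi>(1)]) auto
      ultimately obtain c where "c0 \<le> c" "c \<le> h" "second a c (\<phi> c) = b"
        using IVT' [of "\<lambda>c. second a c (\<phi> c)" c0 b h] c0(2) by auto
      then show thesis
        using \<phi> found order_trans [OF c0(1)] by blast
    qed
  next
    case (fold l z)
    have "\<exists>q\<ge>0. curve a c q = 0 \<and> 0 \<le> s * curve_slope a c q"
      if c: "l \<le> c" "c \<le> h" "s \<in> {-1, 1}" for c s
    proof (cases "c = l")
      case True
      then show ?thesis
        using fold(3-5) by auto
    next
      case False
      then have "l < c" "0 \<le> c"
        using c fold(1) by auto
      then show ?thesis
        using fold(6) [OF _ c(2)] branches_of_negative [OF _ c(2) h(2) _ _ c(3)] by blast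
    qed
    then obtain \<phi> \<psi> where \<phi>\<psi>: "continuous_on {l..h} \<phi>" "continuous_on {l..h} \<psi>"
      and \<phi>: "\<And>c. l \<le> c \<Longrightarrow> c \<le> h \<Longrightarrow> 0 < \<phi> c \<and> curve a c (\<phi> c) = 0 \<and> curve_slope a c (\<phi> c) \<le> 0"
      and \<psi>: "\<And>c. l \<le> c \<Longrightarrow> c \<le> h \<Longrightarrow> 0 < \<psi> c \<and> curve a c (\<psi> c) = 0 \<and> 0 \<le> curve_slope a c (\<psi> c)"
      using two_branches [OF fold(1) h(2)] by blast
    have meet: "\<phi> l = z" "\<psi> l = z"
      using branch_unique [of l h a "-1" "\<phi> l" z] branch_unique [of l h a 1 "\<psi> l" z]
        \<phi> [of l] \<psi> [of l] fold(1-5) h(2) by auto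
    show thesis
    proof (cases "b \<le> second a l z")
      case True
      moreover have "second a h (\<psi> h) \<le> b"
        using low \<psi> fold(2) by simp
      moreover have "continuous_on {l..h} (\<lambda>c. second a c (\<psi> c))"
        using \<phi>\<psi>(2) \<psi> by (intro continuous_on_second_branch) auto
      ultimately obtain c where "l \<le> c" "c \<le> h" "second a c (\<psi> c) = b"
        using IVT2' [of "\<lambda>c. second a c (\<psi> c)" h b l] fold(2) meet by auto
      then show thesis
        using \<psi> found order_trans [OF fold(1)] by blast
    next
      case False
      moreover have "b \<le> second a h (\<phi> h)"
        using high' \<phi> fold(2) by simp
      moreover have "continuous_on {l..h} (\<lambda>c. second a c (\<phi> c))"
        using \<phi>\<psi>(1) \<phi> by (intro continuous_on_second_branch) auto
      ultimately obtain c where "l \<le> c" "c \<le> h" "second a c (\<phi> c) = b"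
        using IVT' [of "\<lambda>c. second a c (\<phi> c)" l b h] fold(2) meet by auto
      then show thesis
        using \<phi> found order_trans [OF fold(1)] by blast
    qed
  qed
qed

lemma quadrant_map_in_open_quadrant: "quadrant_map p \<in> open_quadrant"
proof -
  obtain x y where p: "p = (x, y)"
    by force
  have "0 < (x^2 * y^4 + x^4 * y^2 - y^2 - 1)^2 + x^6 * y^4"
  proof (cases "x = 0 \<or> y = 0")
    case True
    moreover have "- (y^2) - 1 \<noteq> 0"
      using zero_le_power2 [of y] by linarith
    ultimately show ?thesis
      by auto
  next
    case False
    then have "0 < x^6 * y^4"
      by simp
    then show ?thesis
      by (simp add: add_nonneg_pos)
  qed
  moreover have "0 < (x^6 * y^2 + x^2 * y^2 - x^2 - 1)^2 + x^6 * y^4"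
  proof (cases "x = 0 \<or> y = 0")
    case True
    moreover have "- (x^2) - 1 \<noteq> 0"
      using zero_le_power2 [of x] by linarith
    ultimately show ?thesis
      by auto
  next
    case False
    then have "0 < x^6 * y^4"
      by simp
    then show ?thesis
      by (simp add: add_nonneg_pos)
  qed
  ultimately show ?thesis
    by (simp add: p quadrant_map_def open_quadrant_def)
qed

theorem theorem1p3:
  shows "open_quadrant = range quadrant_map"
proof
  show "open_quadrant \<subseteq> range quadrant_map"
  proof
    fix p assume "p \<in> open_quadrant"
    then obtain a b where p: "p = (a, b)" "0 < a" "0 < b"
      by (auto simp: open_quadrant_def)
    then show "p \<in> range quadrant_map"
      using curve_point_with_second_value [of a b] quadrant_map_at_curve_point by metis
  qed
  show "range quadrant_map \<subseteq> open_quadrant"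
    using quadrant_map_in_open_quadrant by blast
qed

end
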